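(* The multiple-conclusion Hilbert system $\mathsf{R}_{\mathrm{PWK}}$ below is $\{p,\neg p\}$-analytic, and $\rhd_{\mathsf{R}_{\mathrm{PWK}}} \;=\; \rhd_{\mathrm{PWK}}$.
   Context: $L$: formulas over a countably infinite set of variables with binary $\land,\lor$ and unary $\neg$. $\mathbf A$: algebra on $\{f,u,t\}$ where each connective acts classically on $\{f,t\}$-arguments and returns $u$ if any argument is $u$. Valuations: homomorphisms into $\mathbf A$. For $\Gamma,\Delta\subseteq L$, $\Gamma\rhd_{\mathrm{PWK}}\Delta$ iff there is no valuation $v$ with $v[\Gamma]\subseteq\{u,t\}$ and $v[\Delta]\subseteq\{f\}$. A Set-Set Hilbert system is a set of rule schemas $\Pi/\Sigma$ ($\Pi,\Sigma$ finite sets of formulas, possibly empty), with all substitution instances as rules. A derivation is a finite rooted tree whose nodes are labelled by sets of formulas or by the symbol $\star$: a non-leaf node labelled $\Lambda$ either has a single child labelled $\star$, provided some rule instance $\Pi/\varnothing$ has $\Pi\subseteq\Lambda$, or has children labelled $\Lambda\cup\{\psi_1\},\dots,\Lambda\cup\{\psi_m\}$ for some rule instance $\Pi/\{\psi_1,\dots,\psi_m\}$ ($m\ge1$) with $\Pi\subseteq\Lambda$. A proof of $(\Gamma,\Delta)$ is a derivation whose root is labelled by a subset of $\Gamma$ and each of whose leaves is labelled $\star$ or by a set meeting $\Delta$; $\Gamma\rhd_{\mathsf R}\Delta$ iff such a proof exists. $\mathsf R$ is $\{p,\neg p\}$-analytic if whenever $\Gamma\rhd_{\mathsf R}\Delta$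 there is a proof of $(\Gamma,\Delta)$ all of whose node labels contain only formulas in $S\cup\{\neg\psi:\psi\in S\}$, where $S$ is the set of subformulas of formulas in $\Gamma\cup\Delta$. $\mathsf{R}_{\mathrm{PWK}}$ has rule schemas: $\varnothing/p,\neg p$; $p/\neg\neg p$; $\neg\neg p/p$; $p,q/p\land q$; $p\land q/p,q$; $p\land q/p,\neg q$; $p\land q/\neg p,q$; $\neg(p\land q)/\neg p,\neg q$; $p,\neg p/p\land q$; $\neg p/\neg(p\land q)$; $q,\neg q/p\land q$; $\neg q/\neg(p\land q)$; $p/p\lor q$; $q/p\lor q$; $p\lor q/p,q$; $\neg(p\lor q)/p,\neg q$; $\neg(p\lor q)/\neg p,q$; $\neg(p\lor q)/\neg p,\neg q$; $p,\neg p/\neg(p\lor q)$; $q,\neg q/\neg(p\lor q)$. *)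

theory Defs
  imports Main "HOL-Library.FSet"
begin

datatype form = Var nat | Neg form | And form form | Or form form

primrec subforms :: "form \<Rightarrow> form set" where
  "subforms (Var x) = {Var x}"
| "subforms (Neg \<phi>) = insert (Neg \<phi>) (subforms \<phi>)"
| "subforms (And \<phi> \<psi>) = insert (And \<phi> \<psi>) (subforms \<phi> \<union> subforms \<psi>)"
| "subforms (Or \<phi> \<psi>) = insert (Or \<phi> \<psi>) (subforms \<phi> \<union> subforms \<psi>)"

primrec subst :: "(nat \<Rightarrow> form) \<Rightarrow> form \<Rightarrow> form" where
  "subst \<sigma> (Var x) = \<sigma> x"
| "subst \<sigma> (Neg \<phi>) = Neg (subst \<sigma> \<phi>)"
| "subst \<sigma> (And \<phi> \<psi>) = And (subst \<sigma> \<phi>) (subst \<sigma> \<psi>)"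
| "subst \<sigma> (Or \<phi> \<psi>) = Or (subst \<sigma> \<phi>) (subst \<sigma> \<psi>)"

datatype tv = ff | uu | tt

definition tv_of_bool :: "bool \<Rightarrow> tv" where
  "tv_of_bool b = (if b then tt else ff)"

definition neg_tv :: "tv \<Rightarrow> tv" where
  "neg_tv a = (if a = uu then uu else tv_of_bool (\<not> a = tt))"

definition and_tv :: "tv \<Rightarrow> tv \<Rightarrow> tv" where
  "and_tv a b = (if a = uu \<or> b = uu then uu else tv_of_bool (a = tt \<and> b = tt))"

definition or_tv :: "tv \<Rightarrow> tv \<Rightarrow> tv" where
  "or_tv a b = (if a = uu \<or> b = uu then uu else tv_of_bool (a = tt \<or> b = tt))"

definition valuation :: "(form \<Rightarrow> tv) \<Rightarrow> bool" where
  "valuation v \<longleftrightarrow>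
     (\<forall>\<phi>. v (Neg \<phi>) = neg_tv (v \<phi>)) \<and>
     (\<forall>\<phi> \<psi>. v (And \<phi> \<psi>) = and_tv (v \<phi>) (v \<psi>)) \<and>
     (\<forall>\<phi> \<psi>. v (Or \<phi> \<psi>) = or_tv (v \<phi>) (v \<psi>))"

definition PWK :: "form set \<Rightarrow> form set \<Rightarrow> bool" where
  "PWK \<Gamma> \<Delta> \<longleftrightarrow> \<not> (\<exists>v. valuation v \<and> v ` \<Gamma> \<subseteq> {uu, tt} \<and> v ` \<Delta> \<subseteq> {ff})"

text \<open>A rule (schema) \<open>\<Pi>/\<Sigma>\<close> is a pair of finite sets of formulas; a Set-Set Hilbert system is a set
  of rule schemas.\<close>

type_synonym rule = "form fset \<times> form fset"

definition instances :: "rule set \<Rightarrow> rule set" where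
  "instances R = {(subst \<sigma> |`| \<Pi>, subst \<sigma> |`| \<Sigma>) | \<sigma> \<Pi> \<Sigma>. (\<Pi>, \<Sigma>) \<in> R}"

datatype 'a rtree = Node (root: 'a) (children: "'a rtree list")

primrec leaf_labels :: "'a rtree \<Rightarrow> 'a set" where
  "leaf_labels (Node l ts) = (if ts = [] then {l} else \<Union> (set (map leaf_labels ts)))"

datatype label = Star | Fms "form set"

text \<open>In \<open>expand\<close>, the list \<open>\<psi>s\<close> enumerates the succedent of a rule instance with nonempty succedent.
  A node labelled \<open>Star\<close> is always a leaf.\<close>

inductive derivation :: "rule set \<Rightarrow> label rtree \<Rightarrow> bool" for R where
  leaf: "derivation R (Node l [])"
| star: "(\<Pi>, {||}) \<in> instances R \<Longrightarrow> fset \<Pi> \<subseteq> \<Lambda>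
     \<Longrightarrow> derivation R (Node (Fms \<Lambda>) [Node Star []])"
| expand: "(\<Pi>, fset_of_list \<psi>s) \<in> instances R \<Longrightarrow> \<psi>s \<noteq> [] \<Longrightarrow> fset \<Pi> \<subseteq> \<Lambda>
     \<Longrightarrow> map root ts = map (\<lambda>\<psi>. Fms (\<Lambda> \<union> {\<psi>})) \<psi>s
     \<Longrightarrow> (\<And>t. t \<in> set ts \<Longrightarrow> derivation R t)
     \<Longrightarrow> derivation R (Node (Fms \<Lambda>) ts)"

definition is_proof :: "rule set \<Rightarrow> form set \<Rightarrow> form set \<Rightarrow> label rtree \<Rightarrow> bool" where
  "is_proof R \<Gamma> \<Delta> t \<longleftrightarrow>
     derivation R t \<and>
     (\<exists>\<Lambda>. root t = Fms \<Lambda> \<and> \<Lambda> \<subseteq> \<Gamma>) \<and>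
     (\<forall>l \<in> leaf_labels t. l = Star \<or> (\<exists>\<Lambda>. l = Fms \<Lambda> \<and> \<Lambda> \<inter> \<Delta> \<noteq> {}))"

definition derives :: "rule set \<Rightarrow> form set \<Rightarrow> form set \<Rightarrow> bool" where
  "derives R \<Gamma> \<Delta> \<longleftrightarrow> (\<exists>t. is_proof R \<Gamma> \<Delta> t)"

text \<open>\<open>{p, \<not>p}\<close>-analyticity; \<open>set_rtree t\<close> is the set of labels of all nodes of \<open>t\<close>.\<close>

definition p_neg_p_analytic :: "rule set \<Rightarrow> bool" where
  "p_neg_p_analytic R \<longleftrightarrow>
     (\<forall>\<Gamma> \<Delta>. derives R \<Gamma> \<Delta> \<longrightarrow>
       (let S = \<Union> (subforms ` (\<Gamma> \<union> \<Delta>))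
        in \<exists>t. is_proof R \<Gamma> \<Delta> t \<and>
             (\<forall>\<Lambda>. Fms \<Lambda> \<in> set_rtree t \<longrightarrow> \<Lambda> \<subseteq> S \<union> {Neg \<psi> | \<psi>. \<psi> \<in> S})))"

definition R_PWK :: "rule set" where
  "R_PWK = (let p = Var 0; q = Var 1 in {
     ({||}, {|p, Neg p|}),
     ({|p|}, {|Neg (Neg p)|}),
     ({|Neg (Neg p)|}, {|p|}),
     ({|p, q|}, {|And p q|}),
     ({|And p q|}, {|p, q|}),
     ({|And p q|}, {|p, Neg q|}),
     ({|And p q|}, {|Neg p, q|}),
     ({|Neg (And p q)|}, {|Neg p, Neg q|}),
     ({|p, Neg p|}, {|And p q|}),
     ({|Neg p|}, {|Neg (And p q)|}),
     ({|q, Neg q|}, {|And p q|}),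
     ({|Neg q|}, {|Neg (And p q)|}),
     ({|p|}, {|Or p q|}),
     ({|q|}, {|Or p q|}),
     ({|Or p q|}, {|p, q|}),
     ({|Neg (Or p q)|}, {|p, Neg q|}),
     ({|Neg (Or p q)|}, {|Neg p, q|}),
     ({|Neg (Or p q)|}, {|Neg p, Neg q|}),
     ({|p, Neg p|}, {|Neg (Or p q)|}),
     ({|q, Neg q|}, {|Neg (Or p q)|})})"

end

theory Submission
  imports Defs
begin

text \<open>Soundness holds because every rule preserves designation along some branch of a derivation.
  For completeness, suppose that \<open>(\<Gamma>, \<Delta>)\<close> has no proof inside \<open>U = S \<union> \<not>S\<close>. Since proofs use finitely
  many premises, Zorn's lemma extends \<open>\<Gamma>\<close> to a set \<open>T \<subseteq> U\<close> maximal with this property. Maximality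
  makes \<open>T\<close> closed under the rules within \<open>U\<close> (some conclusion belongs to \<open>T\<close> whenever all premises
  do), so membership of \<open>\<phi>\<close> and \<open>\<not>\<phi>\<close> in \<open>T\<close> determines a truth value of each \<open>\<phi> \<in> S\<close>, and the rules
  say exactly that these values follow the truth tables. The resulting countermodel shows that every
  PWK-consequence has an analytic proof, and analyticity follows by soundness.\<close>

section \<open>Provability within a set of formulas\<close>

text \<open>Derivability without trees. An empty \<open>\<Sigma>\<close> leaves nothing to check,
  which matches a child labelled \<open>Star\<close>. As added formulas lie in \<open>U\<close>, all
  labels do once the root's label does.\<close>

inductive provable :: "rule set \<Rightarrow> form set \<Rightarrow> form set \<Rightarrow> form set \<Rightarrow> bool"
  for R :: "rule set" and U :: "form set" and \<Delta> :: "form set" where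
  meet: "\<Lambda> \<inter> \<Delta> \<noteq> {} \<Longrightarrow> provable R U \<Delta> \<Lambda>"
| step: "(\<Pi>, \<Sigma>) \<in> instances R \<Longrightarrow> fset \<Pi> \<subseteq> \<Lambda> \<Longrightarrow> fset \<Sigma> \<subseteq> U
     \<Longrightarrow> (\<And>\<psi>. \<psi> \<in> fset \<Sigma> \<Longrightarrow> provable R U \<Delta> (insert \<psi> \<Lambda>)) \<Longrightarrow> provable R U \<Delta> \<Lambda>"

lemma provable_mono:
  assumes "provable R U \<Delta> \<Lambda>" "\<Lambda> \<subseteq> \<Lambda>'"
  shows "provable R U \<Delta> \<Lambda>'"
  using assms
proof (induction arbitrary: \<Lambda>' rule: provable.induct)
  case (meet \<Lambda>)
  then show ?case by (blast intro: provable.meet)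
next
  case (step \<Pi> \<Sigma> \<Lambda>)
  show ?case
    by (rule provable.step[of \<Pi> \<Sigma>]) (use step in \<open>auto intro!: step.IH\<close>)
qed

text \<open>Branching is finite and each rule has finitely many premises. This is what lets
  unprovability pass to unions of chains.\<close>

lemma provable_finite:
  assumes "provable R U \<Delta> \<Lambda>"
  shows "\<exists>F. finite F \<and> F \<subseteq> \<Lambda> \<and> provable R U \<Delta> F"
  using assms
proof (induction rule: provable.induct)
  case (meet \<Lambda>)
  then obtain \<phi> where "\<phi> \<in> \<Lambda>" "\<phi> \<in> \<Delta>" by blast
  then show ?case by (intro exI[of _ "{\<phi>}"]) (auto intro: provable.meet)
next
  case (step \<Pi> \<Sigma> \<Lambda>)
  then obtain F where F: "\<And>\<psi>. \<psi> \<in> fset \<Sigma> \<Longrightarrow>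
      finite (F \<psi>) \<and> F \<psi> \<subseteq> insert \<psi> \<Lambda> \<and> provable R U \<Delta> (F \<psi>)"
    by metis
  \<comment> \<open>Each branch supplies its own \<psi>, so only the rest of \<open>F \<psi>\<close>
    must come from \<open>\<Lambda>\<close>.\<close>
  define G where "G = fset \<Pi> \<union> (\<Union>\<psi>\<in>fset \<Sigma>. F \<psi> - {\<psi>})"
  have "provable R U \<Delta> G"
  proof (rule provable.step[OF step.hyps(1) _ step.hyps(3)])
    show "fset \<Pi> \<subseteq> G" by (auto simp: G_def)
    fix \<psi> assume \<psi>: "\<psi> \<in> fset \<Sigma>"
    then have "F \<psi> \<subseteq> insert \<psi> G" by (auto simp: G_def)
    then show "provable R U \<Delta> (insert \<psi> G)" using F[OF \<psi>] provable_mono by blast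
  qed
  moreover have "finite G" using F by (auto simp: G_def)
  moreover have "G \<subseteq> \<Lambda>" using F step.hyps(2) by (auto simp: G_def)
  ultimately show ?case by blast
qed

lemma provable_imp_derivation:
  assumes "provable R U \<Delta> \<Lambda>" "\<Lambda> \<subseteq> U"
  shows "\<exists>t. derivation R t \<and> root t = Fms \<Lambda> \<and>
    (\<forall>l\<in>leaf_labels t. l = Star \<or> (\<exists>\<Lambda>. l = Fms \<Lambda> \<and> \<Lambda> \<inter> \<Delta> \<noteq> {})) \<and>
    (\<forall>\<Theta>. Fms \<Theta> \<in> set_rtree t \<longrightarrow> \<Theta> \<subseteq> U)"
  using assms
proof (induction rule: provable.induct)
  case (meet \<Lambda>)
  then show ?case
    by (intro exI[of _ "Node (Fms \<Lambda>) []"]) (auto intro: derivation.leaf)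
next
  case (step \<Pi> \<Sigma> \<Lambda>)
  show ?case
  proof (cases "\<Sigma> = {||}")
    case True
    then show ?thesis
      using step.hyps step.prems
      by (intro exI[of _ "Node (Fms \<Lambda>) [Node Star []]"]) (auto intro: derivation.star)
  next
    case False
    obtain \<psi>s where \<psi>s: "fset_of_list \<psi>s = \<Sigma>"
      using exists_fset_of_list by blast
    then have set_\<psi>s: "set \<psi>s = fset \<Sigma>"
      by (metis fset_of_list.rep_eq)
    have ne: "\<psi>s \<noteq> []" using \<psi>s False by auto
    have "\<forall>\<psi>\<in>fset \<Sigma>. \<exists>t. derivation R t \<and> root t = Fms (insert \<psi> \<Lambda>) \<and>
      (\<forall>l\<in>leaf_labels t. l = Star \<or> (\<exists>\<Lambda>. l = Fms \<Lambda> \<and> \<Lambda> \<inter> \<Delta> \<noteq> {})) \<and>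
      (\<forall>\<Theta>. Fms \<Theta> \<in> set_rtree t \<longrightarrow> \<Theta> \<subseteq> U)"
      using step.IH step.hyps(3) step.prems by blast
    then obtain f where f: "\<And>\<psi>. \<psi> \<in> fset \<Sigma> \<Longrightarrow> derivation R (f \<psi>) \<and> root (f \<psi>) = Fms (insert \<psi> \<Lambda>) \<and>
      (\<forall>l\<in>leaf_labels (f \<psi>). l = Star \<or> (\<exists>\<Lambda>. l = Fms \<Lambda> \<and> \<Lambda> \<inter> \<Delta> \<noteq> {})) \<and>
      (\<forall>\<Theta>. Fms \<Theta> \<in> set_rtree (f \<psi>) \<longrightarrow> \<Theta> \<subseteq> U)"
      by metis
    have "derivation R (Node (Fms \<Lambda>) (map f \<psi>s))"
      by (rule derivation.expand[of \<Pi> \<psi>s]) (use step.hyps \<psi>s ne f set_\<psi>s in auto)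
    then show ?thesis
      using f ne set_\<psi>s step.prems
      by (intro exI[of _ "Node (Fms \<Lambda>) (map f \<psi>s)"]) auto
  qed
qed

corollary provable_imp_is_proof:
  assumes "provable R U \<Delta> \<Gamma>" "\<Gamma> \<subseteq> U"
  shows "\<exists>t. is_proof R \<Gamma> \<Delta> t \<and> (\<forall>\<Lambda>. Fms \<Lambda> \<in> set_rtree t \<longrightarrow> \<Lambda> \<subseteq> U)"
  using provable_imp_derivation[OF assms] unfolding is_proof_def by blast

text \<open>The multiple-conclusion analogue of a prime theory, relative to \<open>U\<close>. An
  instance with empty succedent forbids \<open>T\<close> to contain all its premises.\<close>

definition saturated :: "rule set \<Rightarrow> form set \<Rightarrow> form set \<Rightarrow> bool" where
  "saturated R U T \<longleftrightarrow> (\<forall>(\<Pi>, \<Sigma>)\<in>instances R.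
     fset \<Pi> \<subseteq> T \<longrightarrow> fset \<Sigma> \<subseteq> U \<longrightarrow> fset \<Sigma> \<inter> T \<noteq> {})"

lemma unprovable_extends_to_saturated:
  assumes "\<not> provable R U \<Delta> \<Gamma>" "\<Gamma> \<subseteq> U"
  obtains T where "\<Gamma> \<subseteq> T" "T \<subseteq> U" "T \<inter> \<Delta> = {}" "saturated R U T"
proof -
  define A where "A = {T. \<Gamma> \<subseteq> T \<and> T \<subseteq> U \<and> \<not> provable R U \<Delta> T}"
  have "\<exists>T\<in>A. \<forall>X\<in>A. T \<subseteq> X \<longrightarrow> X = T"
  proof (rule subset_Zorn_nonempty)
    have "\<Gamma> \<in> A" using assms by (simp add: A_def)
    then show "A \<noteq> {}" by blast
    fix \<C> assume \<C>: "\<C> \<noteq> {}" "subset.chain A \<C>"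
    \<comment> \<open>A finite part of the union that suffices for a proof already lies in one
      member of the chain.\<close>
    have "\<not> provable R U \<Delta> (\<Union>\<C>)"
    proof
      assume "provable R U \<Delta> (\<Union>\<C>)"
      from provable_finite[OF this]
      obtain F where F: "finite F" "F \<subseteq> \<Union>\<C>" "provable R U \<Delta> F" by blast
      obtain X where X: "X \<in> \<C>" "F \<subseteq> X"
        using finite_subset_Union_chain[OF F(1,2) \<C>] .
      from X(1) \<C>(2) have "X \<in> A" by (auto simp: subset.chain_def)
      with provable_mono[OF F(3) X(2)] show False by (simp add: A_def)
    qed
    moreover have "\<Gamma> \<subseteq> X" "X \<subseteq> U" if "X \<in> \<C>" for X
      using that \<C>(2) by (auto simp: A_def subset.chain_def)
    ultimately show "\<Union>\<C> \<in> A" using \<C>(1) unfolding A_def by blast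
  qed
  then obtain T where T: "T \<in> A" and max: "\<And>X. X \<in> A \<Longrightarrow> T \<subseteq> X \<Longrightarrow> X = T" by blast
  show thesis
  proof (rule that[of T])
    show "\<Gamma> \<subseteq> T" "T \<subseteq> U" using T by (auto simp: A_def)
    show "T \<inter> \<Delta> = {}" using T provable.meet[of T \<Delta> R U] by (auto simp: A_def)
    \<comment> \<open>If an applicable rule had no conclusion in \<open>T\<close>, each branch would
      properly extend \<open>T\<close> inside \<open>U\<close>, hence be provable by maximality;
      then \<open>T\<close> would be provable too.\<close>
    have False if *: "(\<Pi>, \<Sigma>) \<in> instances R" "fset \<Pi> \<subseteq> T" "fset \<Sigma> \<subseteq> U"
      and disj: "fset \<Sigma> \<inter> T = {}" for \<Pi> \<Sigma>
    proof -
      have "provable R U \<Delta> (insert \<psi> T)" if "\<psi> \<in> fset \<Sigma>" for \<psi>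
      proof (rule ccontr)
        assume "\<not> provable R U \<Delta> (insert \<psi> T)"
        then have "insert \<psi> T \<in> A" using T that *(3) by (auto simp: A_def)
        then show False using max[of "insert \<psi> T"] that disj by blast
      qed
      with * have "provable R U \<Delta> T" by (rule provable.step)
      then show False using T by (simp add: A_def)
    qed
    then show "saturated R U T" unfolding saturated_def by blast
  qed
qed

section \<open>Rule instances and soundness\<close>

definition PWK_rules :: "form \<Rightarrow> form \<Rightarrow> rule set" where
  "PWK_rules p q = {
     ({||}, {|p, Neg p|}),
     ({|p|}, {|Neg (Neg p)|}),
     ({|Neg (Neg p)|}, {|p|}),
     ({|p, q|}, {|And p q|}),
     ({|And p q|}, {|p, q|}),
     ({|And p q|}, {|p, Neg q|}),
     ({|And p q|}, {|Neg p, q|}),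
     ({|Neg (And p q)|}, {|Neg p, Neg q|}),
     ({|p, Neg p|}, {|And p q|}),
     ({|Neg p|}, {|Neg (And p q)|}),
     ({|q, Neg q|}, {|And p q|}),
     ({|Neg q|}, {|Neg (And p q)|}),
     ({|p|}, {|Or p q|}),
     ({|q|}, {|Or p q|}),
     ({|Or p q|}, {|p, q|}),
     ({|Neg (Or p q)|}, {|p, Neg q|}),
     ({|Neg (Or p q)|}, {|Neg p, q|}),
     ({|Neg (Or p q)|}, {|Neg p, Neg q|}),
     ({|p, Neg p|}, {|Neg (Or p q)|}),
     ({|q, Neg q|}, {|Neg (Or p q)|})}"

text \<open>The schemas mention only \<open>Var 0\<close> and \<open>Var 1\<close>, so a
  substitution matters only through its values there, and these are arbitrary.\<close>

lemma instances_R_PWK: "instances R_PWK = (\<Union>p q. PWK_rules p q)"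
proof -
  have "instances R_PWK = (\<Union>\<sigma>. map_prod (fimage (subst \<sigma>)) (fimage (subst \<sigma>)) ` R_PWK)"
    unfolding instances_def by force
  also have "\<dots> = (\<Union>\<sigma> :: nat \<Rightarrow> form. PWK_rules (\<sigma> 0) (\<sigma> 1))"
    by (simp add: R_PWK_def PWK_rules_def Let_def)
  also have "\<dots> = (\<Union>p q. PWK_rules p q)"
  proof (intro equalityI subsetI)
    fix r assume "r \<in> (\<Union>p q. PWK_rules p q)"
    then obtain p q where "r \<in> PWK_rules p q" by blast
    then show "r \<in> (\<Union>\<sigma> :: nat \<Rightarrow> form. PWK_rules (\<sigma> 0) (\<sigma> 1))"
      by (intro UN_I[of "\<lambda>n. if n = 0 then p else q"]) auto
  qed blast
  finally show ?thesis .
qed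

lemma PWK_rules_sound:
  assumes "valuation v" "(\<Pi>, \<Sigma>) \<in> PWK_rules p q" "\<forall>\<phi>\<in>fset \<Pi>. v \<phi> \<noteq> ff"
  shows "\<exists>\<psi>\<in>fset \<Sigma>. v \<psi> \<noteq> ff"
  using assms
  by (cases "v p"; cases "v q")
    (auto simp: PWK_rules_def valuation_def neg_tv_def and_tv_def or_tv_def tv_of_bool_def)

text \<open>Descend from the root, choosing at each expansion a child whose new formula is
  designated. A \<open>Star\<close> child cannot occur on this path, since designated premises force
  a designated conclusion.\<close>

lemma derivation_designated_leaf:
  assumes "derivation R_PWK t" "valuation v" "root t = Fms \<Lambda>" "\<forall>\<phi>\<in>\<Lambda>. v \<phi> \<noteq> ff"
  shows "\<exists>\<Theta>. Fms \<Theta> \<in> leaf_labels t \<and> (\<forall>\<phi>\<in>\<Theta>. v \<phi> \<noteq> ff)"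
  using assms
proof (induction arbitrary: \<Lambda> rule: derivation.induct)
  case (leaf l)
  then show ?case by auto
next
  case (star \<Pi> \<Lambda>')
  have "\<forall>\<phi>\<in>fset \<Pi>. v \<phi> \<noteq> ff" using star by auto
  with star.hyps(1) show ?case
    using PWK_rules_sound[OF \<open>valuation v\<close>] by (fastforce simp: instances_R_PWK)
next
  case (expand \<Pi> \<psi>s \<Lambda>' ts)
  have *: "\<forall>\<phi>\<in>fset \<Pi>. v \<phi> \<noteq> ff" using expand.hyps(3) expand.prems by auto
  obtain p q where "(\<Pi>, fset_of_list \<psi>s) \<in> PWK_rules p q"
    using expand.hyps(1) by (auto simp: instances_R_PWK)
  from PWK_rules_sound[OF \<open>valuation v\<close> this *] obtain \<psi> where \<psi>: "\<psi> \<in> set \<psi>s" "v \<psi> \<noteq> ff"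
    by (auto simp: fset_of_list.rep_eq)
  then have "Fms (\<Lambda>' \<union> {\<psi>}) \<in> set (map root ts)"
    unfolding expand.hyps(4) by auto
  then obtain t where t: "t \<in> set ts" "root t = Fms (\<Lambda>' \<union> {\<psi>})" by auto
  have "\<forall>\<phi>\<in>\<Lambda>' \<union> {\<psi>}. v \<phi> \<noteq> ff" using \<psi> expand.prems by auto
  from expand.IH[OF t(1) \<open>valuation v\<close> t(2) this] t(1) show ?case by auto
qed

lemma derives_imp_PWK:
  assumes "derives R_PWK \<Gamma> \<Delta>"
  shows "PWK \<Gamma> \<Delta>"
proof -
  obtain t where proof_t: "is_proof R_PWK \<Gamma> \<Delta> t"
    using assms unfolding derives_def ..
  then obtain \<Lambda> where t: "derivation R_PWK t" "root t = Fms \<Lambda>" "\<Lambda> \<subseteq> \<Gamma>"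
    unfolding is_proof_def by auto
  have leaves: "\<Theta> \<inter> \<Delta> \<noteq> {}" if "Fms \<Theta> \<in> leaf_labels t" for \<Theta>
    using proof_t that unfolding is_proof_def by auto
  have False if v: "valuation v" "v ` \<Gamma> \<subseteq> {uu, tt}" "v ` \<Delta> \<subseteq> {ff}" for v
  proof -
    have "\<forall>\<phi>\<in>\<Lambda>. v \<phi> \<noteq> ff" using v(2) t(3) by force
    from derivation_designated_leaf[OF t(1) v(1) t(2) this]
    obtain \<Theta> where \<Theta>: "Fms \<Theta> \<in> leaf_labels t" "\<forall>\<phi>\<in>\<Theta>. v \<phi> \<noteq> ff" by auto
    with leaves[OF \<Theta>(1)] v(3) show False by auto
  qed
  then show ?thesis unfolding PWK_def by blast
qed

section \<open>Countermodels from saturated sets\<close>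

text \<open>A valuation must respect the connectives on all formulas, while \<open>set_tv T\<close>
  will be shown to do so only within \<open>S\<close>. Hence only its values at variables are kept
  and extended freely.\<close>

primrec eval_form :: "(nat \<Rightarrow> tv) \<Rightarrow> form \<Rightarrow> tv" where
  "eval_form e (Var x) = e x"
| "eval_form e (Neg \<phi>) = neg_tv (eval_form e \<phi>)"
| "eval_form e (And \<phi> \<psi>) = and_tv (eval_form e \<phi>) (eval_form e \<psi>)"
| "eval_form e (Or \<phi> \<psi>) = or_tv (eval_form e \<phi>) (eval_form e \<psi>)"

lemma valuation_eval_form: "valuation (eval_form e)"
  by (simp add: valuation_def)

text \<open>\<open>T\<close> plays the role of the designated formulas. A formula and its negation
  are both designated exactly at \<open>uu\<close>.\<close>

definition set_tv :: "form set \<Rightarrow> form \<Rightarrow> tv" where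
  "set_tv T \<phi> = (if \<phi> \<notin> T then ff else if Neg \<phi> \<in> T then uu else tt)"

text \<open>For a compound formula in \<open>S\<close>, its immediate subformulas and all their
  negations lie in \<open>U\<close>, so saturation applies to the relevant rules and forces the
  truth table row by row.\<close>

lemma eval_form_set_tv:
  assumes "saturated R_PWK (S \<union> {Neg \<psi> |\<psi>. \<psi> \<in> S}) T"
    and "subforms \<phi> \<subseteq> S"
  shows "eval_form (\<lambda>x. set_tv T (Var x)) \<phi> = set_tv T \<phi>"
proof -
  define U where "U = S \<union> {Neg \<psi> |\<psi>. \<psi> \<in> S}"
  have U: "\<psi> \<in> U" "Neg \<psi> \<in> U" if "\<psi> \<in> S" for \<psi>
    using that by (auto simp: U_def)
  have self: "\<psi> \<in> subforms \<psi>" for \<psi>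
    by (cases \<psi>) auto
  have rules: "\<forall>(\<Pi>, \<Sigma>)\<in>PWK_rules p q. fset \<Pi> \<subseteq> T \<longrightarrow> fset \<Sigma> \<subseteq> U \<longrightarrow> fset \<Sigma> \<inter> T \<noteq> {}" for p q
  proof (rule ballI)
    fix r assume "r \<in> PWK_rules p q"
    then have "r \<in> instances R_PWK" by (auto simp: instances_R_PWK)
    with assms(1) show "case r of (\<Pi>, \<Sigma>) \<Rightarrow>
        fset \<Pi> \<subseteq> T \<longrightarrow> fset \<Sigma> \<subseteq> U \<longrightarrow> fset \<Sigma> \<inter> T \<noteq> {}"
      unfolding saturated_def U_def by (rule bspec)
  qed
  have em: "p \<in> T \<or> Neg p \<in> T" if "p \<in> S" for p
  proof -
    have "({||}, {|p, Neg p|}) \<in> PWK_rules p p" by (simp add: PWK_rules_def)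
    with rules have "fset {|p, Neg p|} \<subseteq> U \<longrightarrow> fset {|p, Neg p|} \<inter> T \<noteq> {}" by fastforce
    with U[OF that] show ?thesis by auto
  qed
  show ?thesis
    using assms(2)
  proof (induction \<phi>)
    case (Var x)
    then show ?case by simp
  next
    case (Neg p)
    then have "p \<in> S" "Neg p \<in> S" using self by auto
    \<comment> \<open>The double negation is available because \<open>Neg p\<close> itself belongs
      to \<open>S\<close>.\<close>
    then have "p \<in> U" "Neg p \<in> U" "Neg (Neg p) \<in> U" using U by auto
    with rules[of p p] have "neg_tv (set_tv T p) = set_tv T (Neg p)"
      by (cases "p \<in> T"; cases "Neg p \<in> T"; cases "Neg (Neg p) \<in> T")
        (simp_all add: PWK_rules_def neg_tv_def tv_of_bool_def set_tv_def)
    with Neg show ?case by simp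
  next
    case (And p q)
    then have "p \<in> S" "q \<in> S" "And p q \<in> S" using self by auto
    then have "p \<in> U" "Neg p \<in> U" "q \<in> U" "Neg q \<in> U" "And p q \<in> U" "Neg (And p q) \<in> U"
      using U by auto
    \<comment> \<open>The instances in \<open>rules[of p q]\<close> include excluded middle for
      \<open>p\<close> only, so it is added for \<open>q\<close>.\<close>
    moreover have "q \<in> T \<or> Neg q \<in> T"
      using em \<open>q \<in> S\<close> .
    ultimately have "and_tv (set_tv T p) (set_tv T q) = set_tv T (And p q)"
      using rules[of p q]
      by (cases "p \<in> T"; cases "Neg p \<in> T"; cases "q \<in> T"; cases "Neg q \<in> T";
          cases "And p q \<in> T"; cases "Neg (And p q) \<in> T")
        (simp_all add: PWK_rules_def and_tv_def tv_of_bool_def set_tv_def)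
    with And show ?case by simp
  next
    case (Or p q)
    then have "p \<in> S" "q \<in> S" "Or p q \<in> S" using self by auto
    then have "p \<in> U" "Neg p \<in> U" "q \<in> U" "Neg q \<in> U" "Or p q \<in> U" "Neg (Or p q) \<in> U"
      using U by auto
    moreover have "q \<in> T \<or> Neg q \<in> T"
      using em \<open>q \<in> S\<close> .
    ultimately have "or_tv (set_tv T p) (set_tv T q) = set_tv T (Or p q)"
      using rules[of p q]
      by (cases "p \<in> T"; cases "Neg p \<in> T"; cases "q \<in> T"; cases "Neg q \<in> T";
          cases "Or p q \<in> T"; cases "Neg (Or p q) \<in> T")
        (simp_all add: PWK_rules_def or_tv_def tv_of_bool_def set_tv_def)
    with Or show ?case by simp
  qed
qed

section \<open>Completeness by analytic proofs\<close>

lemma PWK_imp_analytic_proof: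
  fixes \<Gamma> \<Delta> :: "form set"
  defines "S \<equiv> \<Union> (subforms ` (\<Gamma> \<union> \<Delta>))"
  assumes "PWK \<Gamma> \<Delta>"
  shows "\<exists>t. is_proof R_PWK \<Gamma> \<Delta> t \<and>
    (\<forall>\<Lambda>. Fms \<Lambda> \<in> set_rtree t \<longrightarrow> \<Lambda> \<subseteq> S \<union> {Neg \<psi> |\<psi>. \<psi> \<in> S})"
proof -
  let ?U = "S \<union> {Neg \<psi> |\<psi>. \<psi> \<in> S}"
  have "\<psi> \<in> subforms \<psi>" for \<psi>
    by (cases \<psi>) auto
  then have \<Gamma>: "\<Gamma> \<subseteq> ?U" unfolding S_def by blast
  have "provable R_PWK ?U \<Delta> \<Gamma>"
  proof (rule ccontr)
    assume "\<not> provable R_PWK ?U \<Delta> \<Gamma>"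
    then obtain T where T: "\<Gamma> \<subseteq> T" "T \<subseteq> ?U" "T \<inter> \<Delta> = {}"
        and sat: "saturated R_PWK ?U T"
      using \<Gamma> by (rule unprovable_extends_to_saturated)
    define v where "v = eval_form (\<lambda>x. set_tv T (Var x))"
    have v: "v \<phi> = set_tv T \<phi>" if "\<phi> \<in> \<Gamma> \<union> \<Delta>" for \<phi>
      unfolding v_def by (rule eval_form_set_tv[OF sat]) (use that in \<open>auto simp: S_def\<close>)
    have "v ` \<Gamma> \<subseteq> {uu, tt}" "v ` \<Delta> \<subseteq> {ff}"
      using T v by (auto simp: set_tv_def)
    then show False
      using \<open>PWK \<Gamma> \<Delta>\<close> valuation_eval_form unfolding PWK_def v_def by blast
  qed
  from provable_imp_is_proof[OF this \<Gamma>] show ?thesis .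
qed

theorem theorem4:
  "p_neg_p_analytic R_PWK \<and> derives R_PWK = PWK"
proof
  show "p_neg_p_analytic R_PWK"
    unfolding p_neg_p_analytic_def Let_def
    \<comment> \<open>The given proof is not transformed: soundness turns it into a semantic
      consequence, for which completeness builds an analytic proof.\<close>
    by (intro allI impI PWK_imp_analytic_proof derives_imp_PWK)
  have "derives R_PWK \<Gamma> \<Delta>" if "PWK \<Gamma> \<Delta>" for \<Gamma> \<Delta>
    using PWK_imp_analytic_proof[OF that] unfolding derives_def by auto
  then show "derives R_PWK = PWK"
    by (intro ext iffI derives_imp_PWK)
qed

end
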